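(* Let $T$ be a p-string, $w=\mathsf{prev}(T)$, and name each node $[x]^R_w$ of $\mathsf{PDAWG}(T)=(V_{\mathsf D},E_{\mathsf D})$ by its longest element $\max[x]^R_w$. Let $\mathsf{PSTree}(\overline{T})=(V_{\mathsf T},E_{\mathsf T})$. Then: (1) $x\in V_{\mathsf D}$ if and only if $\widetilde{x}\in V_{\mathsf T}$; (2) $\mathsf{PDAWG}(T)$ has a primary edge $(x,a,y)\in E_{\mathsf D}$ if and only if $\mathsf{PSTree}(\overline{T})$ has an explicit Weiner link $(\widetilde{x},a,\widetilde{y})$; (3) $\mathsf{PDAWG}(T)$ has a secondary edge $(x,a,y)\in E_{\mathsf D}$ if and only if $\mathsf{PSTree}(\overline{T})$ has an implicit Weiner link $(\widetilde{x},a,\widetilde{y})$; (4) $\mathsf{PDAWG}(T)$ has a suffix link from $\widetilde{xy}$ to $\widetilde{x}$ if and only if $\mathsf{PSTree}(\overline{T})$ has an edge $(x,y,xy)\in E_{\mathsf T}$ (from node $x$ with label $y$ to node $xy$).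
   Context: $\Sigma$ (static) and $\Pi$ (parameter) are disjoint alphabets; p-strings are over $\Sigma\cup\Pi$; $\mathcal{N}$ is the non-negative integers; $\overline{T}$ is the reversal of string $T$. $\mathsf{prev}(S)$: $\mathsf{prev}(S)[i]=S[i]$ if $S[i]\in\Sigma$; $=0$ if $S[i]\in\Pi$ does not occur in $S[1:i-1]$; $=i-j$ if $j<i$ is the last earlier position with $S[j]=S[i]\in\Pi$. A pv-string is a string $\mathsf{prev}(S)$. $\mathsf{Z}(a,j)=0$ if $a\in\mathcal{N}$, $a>j$, else $a$; re-encoding $\langle x\rangle[i]=\mathsf{Z}(x[i],i-1)$. For a pv-string $w$: $\mathsf{PFactor}(w)=\{\langle x\rangle: x$ a factor of $w\}$ (and $\mathsf{PFactor}(T)=\mathsf{PFactor}(\mathsf{prev}(T))$); $\mathsf{RPos}_w(x)=\{i\in\{0,\dots,|w|\}: x=\langle w[i-|x|+1:i]\rangle\}$ ($w[i:j]=\varepsilon$ if $i>j$); $[x]^R_w$ is the class of $x$ under equality of $\mathsf{RPos}_w$; $\max,\min$ give its longest/shortest element. $\mathsf{PDAWG}(T)$: nodes $[x]^R_w$ for $x\in\mathsf{PFactor}(w)$, edges $([x]^R_w,c,[y]^R_w)$ with $y=\max[x]^R_w\cdot c$, suffix links $\mathsf{SL}_w([x]^R_w)=[\langle y[2:|y|]\rangle]^R_w$, $y=\min[x]^R_w$ (non-source nodes). An edge $(u,a,v)$ is primary if $\max v=\max u\cdot a$, secondary otherwise. Reverse of a pv-string: $\widetilde{\varepsilon}=\varepsilon$;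 $\widetilde{xa}=a\widetilde{x}$ if $a\in\Sigma\cup\{0\}$; otherwise $\widetilde{xa}=0y$ where $y=\widetilde{x}[1:a-1]\cdot a\cdot\widetilde{x}[a+1:]$ (so $\widetilde{\mathsf{prev}(S)}=\mathsf{prev}(\overline{S})$). $\mathsf{PSuffix}(S)=\{\mathsf{prev}(S'): S'$ suffix of $S\}$; $\mathsf{PSTree}(S)$ is the path-compacted trie of $\mathsf{PSuffix}(S)$, nodes named by the pv-string they spell. Weiner links of $\mathsf{PSTree}(S)$: for a node $v=\mathsf{prev}(R)$ ($R$ a substring of $S$) and $a\in\Sigma\cup\mathcal{N}$, let $\alpha(a,v)=av$ if $av\in\mathsf{PFactor}(S)$ and $a\in\Sigma\cup\{0\}$; $\alpha(a,v)=\mathsf{prev}(R[a]\cdot R)$ if $\mathsf{prev}(R[a]\cdot R)\in\mathsf{PFactor}(S)$ and $a\in\mathcal{N}\setminus\{0\}$; undefined otherwise. A Weiner link is a triple $(v,a,u)$ with $u=\alpha(a,v)z$ for the shortest $z$ such that $\alpha(a,v)z$ is a node of $\mathsf{PSTree}(S)$; it is explicit if $u=\alpha(a,v)$ and implicit otherwise.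
   Formalization: For a in N\{0}, α(a,v) is defined only if also v[a]=0 (R[a] is a parameter first occurring in R at position a); otherwise T=cc, c static, gives a Weiner link (c,1,cc) with no PDAWG edge. Nodes of PSTree include all elements of PSuffix, even non-branching ones. *)

theory Defs
  imports Main "HOL-Library.Sublist"
begin

text \<open>
  The disjoint alphabets \<open>\<Sigma>\<close> and \<open>\<Pi>\<close> are the two summands of \<open>'s + 'p\<close>; strings over
  \<open>\<Sigma> \<union> \<N>\<close> have symbols in \<open>'s + nat\<close>.
  Lists are indexed from 0, so the symbol \<open>S[i]\<close> of the mathematical notation is \<open>S ! (i - 1)\<close>.
\<close>

type_synonym ('s, 'p) pstring = "('s + 'p) list"
type_synonym 's nstring = "('s + nat) list"

definition prev :: "('s, 'p) pstring \<Rightarrow> 's nstring" where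
  "prev S = map (\<lambda>i. case S ! i of
       Inl c \<Rightarrow> Inl c
     | Inr p \<Rightarrow> (if \<exists>j<i. S ! j = S ! i then Inr (i - Max {j. j < i \<and> S ! j = S ! i}) else Inr 0))
     [0..<length S]"

definition pv_strings :: "'p itself \<Rightarrow> 's nstring set" where
  "pv_strings _ = range (prev :: ('s, 'p) pstring \<Rightarrow> 's nstring)"

fun Z :: "'s + nat \<Rightarrow> nat \<Rightarrow> 's + nat" where
  "Z (Inl c) j = Inl c"
| "Z (Inr a) j = (if a > j then Inr 0 else Inr a)"

definition reencode :: "'s nstring \<Rightarrow> 's nstring" where
  "reencode x = map (\<lambda>i. Z (x ! i) i) [0..<length x]"

definition PFactor :: "'s nstring \<Rightarrow> 's nstring set" where
  "PFactor w = {reencode x | x. sublist x w}"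

text \<open>
  The factor \<open>w[i-|x|+1 : i]\<close> only exists for \<open>i \<ge> |x|\<close>.
\<close>

definition RPos :: "'s nstring \<Rightarrow> 's nstring \<Rightarrow> nat set" where
  "RPos w x = {i. length x \<le> i \<and> i \<le> length w \<and>
                  x = reencode (take (length x) (drop (i - length x) w))}"

definition RClass :: "'s nstring \<Rightarrow> 's nstring \<Rightarrow> 's nstring set" where
  "RClass w x = {y. RPos w y = RPos w x}"

definition longest :: "'a list set \<Rightarrow> 'a list" where
  "longest A = (ARG_MAX length x. x \<in> A)"

definition shortest :: "'a list set \<Rightarrow> 'a list" where
  "shortest A = (ARG_MIN length x. x \<in> A)"


subsection \<open>Parameterized DAWGs\<close>

definition PDAWG_nodes :: "'s nstring \<Rightarrow> 's nstring set set" where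
  "PDAWG_nodes w = RClass w ` PFactor w"

definition PDAWG_edges ::
    "'s nstring \<Rightarrow> ('s nstring set \<times> ('s + nat) \<times> 's nstring set) set" where
  "PDAWG_edges w = {(RClass w x, c, RClass w y) | x c y.
     x \<in> PFactor w \<and> y \<in> PFactor w \<and> y = longest (RClass w x) @ [c]}"

definition PDAWG_primary ::
    "'s nstring \<Rightarrow> ('s nstring set \<times> ('s + nat) \<times> 's nstring set) set" where
  "PDAWG_primary w = {(u, a, v) \<in> PDAWG_edges w. longest v = longest u @ [a]}"

definition PDAWG_secondary ::
    "'s nstring \<Rightarrow> ('s nstring set \<times> ('s + nat) \<times> 's nstring set) set" where
  "PDAWG_secondary w = PDAWG_edges w - PDAWG_primary w"

definition PDAWG_suffix_links :: "'s nstring \<Rightarrow> ('s nstring set \<times> 's nstring set) set" where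
  "PDAWG_suffix_links w = {(u, RClass w (reencode (tl (shortest u)))) | u.
     u \<in> PDAWG_nodes w \<and> u \<noteq> RClass w []}"

definition name_edge ::
    "'a list set \<times> 'a \<times> 'a list set \<Rightarrow> 'a list \<times> 'a \<times> 'a list" where
  "name_edge = (\<lambda>(u, a, v). (longest u, a, longest v))"

definition name_link :: "'a list set \<times> 'a list set \<Rightarrow> 'a list \<times> 'a list" where
  "name_link = (\<lambda>(u, v). (longest u, longest v))"


subsection \<open>Reversal of pv-strings\<close>

definition pv_reverse_step :: "'s nstring \<Rightarrow> 's + nat \<Rightarrow> 's nstring" where
  "pv_reverse_step z a = (case a of
       Inl c \<Rightarrow> a # z
     | Inr n \<Rightarrow> (if n = 0 then a # z else Inr 0 # take (n - 1) z @ [a] @ drop n z))"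

definition pv_reverse :: "'s nstring \<Rightarrow> 's nstring" where
  "pv_reverse x = foldl pv_reverse_step [] x"

lemma pv_reverse_Nil [simp]: "pv_reverse [] = []"
  by (simp add: pv_reverse_def)

lemma pv_reverse_snoc:
  "pv_reverse (x @ [Inl c]) = Inl c # pv_reverse x"
  "pv_reverse (x @ [Inr 0]) = Inr 0 # pv_reverse x"
  "n > 0 \<Longrightarrow> pv_reverse (x @ [Inr n]) =
     Inr 0 # take (n - 1) (pv_reverse x) @ [Inr n] @ drop n (pv_reverse x)"
  by (simp_all add: pv_reverse_def pv_reverse_step_def)


subsection \<open>Parameterized suffix trees\<close>

definition PSuffix :: "('s, 'p) pstring \<Rightarrow> 's nstring set" where
  "PSuffix S = {prev S' | S'. suffix S' S}"

definition trie :: "'a list set \<Rightarrow> 'a list set" where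
  "trie W = {v. \<exists>s\<in>W. prefix v s}"

text \<open>
  Path compaction suppresses the non-root nodes with a single child, except those that
  represent an element of \<open>W\<close>. No end marker is assumed, so an element of \<open>W\<close> need not be a leaf.
\<close>

definition compact_nodes :: "'a list set \<Rightarrow> 'a list set" where
  "compact_nodes W = {v \<in> trie W. v = [] \<or> v \<in> W \<or>
     (\<exists>a b. a \<noteq> b \<and> v @ [a] \<in> trie W \<and> v @ [b] \<in> trie W)}"

definition compact_edges :: "'a list set \<Rightarrow> ('a list \<times> 'a list \<times> 'a list) set" where
  "compact_edges W = {(u, y, v). u \<in> compact_nodes W \<and> v \<in> compact_nodes W \<and>
     v = u @ y \<and> y \<noteq> [] \<and>
     \<not> (\<exists>z \<in> compact_nodes W. strict_prefix u z \<and> strict_prefix z v)}"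

definition PSTree_nodes :: "('s, 'p) pstring \<Rightarrow> 's nstring set" where
  "PSTree_nodes S = compact_nodes (PSuffix S)"

definition PSTree_edges :: "('s, 'p) pstring \<Rightarrow> ('s nstring \<times> 's nstring \<times> 's nstring) set" where
  "PSTree_edges S = compact_edges (PSuffix S)"

text \<open>
  \<open>weiner_ext S a v u\<close> says that \<open>\<alpha>(a, v)\<close> is defined and equal to \<open>u\<close>.
  For \<open>a \<in> \<N> - {0}\<close>, the label \<open>a\<close> is the distance from the prepended symbol \<open>R[a]\<close> to its next
  occurrence in \<open>R[a] \<cdot> R\<close>: \<open>R[a]\<close> is a parameter and \<open>a\<close> is its first position in \<open>R\<close>, that is,
  \<open>v[a] = 0\<close>. Without this condition, static symbols and later occurrences of the same parameter
  would give further numeric labels to one and the same extension.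
\<close>

definition weiner_ext ::
    "('s, 'p) pstring \<Rightarrow> 's + nat \<Rightarrow> 's nstring \<Rightarrow> 's nstring \<Rightarrow> bool" where
  "weiner_ext S a v u \<longleftrightarrow> u \<in> PFactor (prev S) \<and>
     (\<exists>R. sublist R S \<and> v = prev R \<and>
       (case a of
          Inl c \<Rightarrow> u = a # v
        | Inr n \<Rightarrow> (if n = 0 then u = a # v
                    else n \<le> length R \<and> v ! (n - 1) = Inr 0 \<and> u = prev (R ! (n - 1) # R))))"

definition weiner_links ::
    "('s, 'p) pstring \<Rightarrow> ('s nstring \<times> ('s + nat) \<times> 's nstring) set" where
  "weiner_links S = {(v, a, u). v \<in> PSTree_nodes S \<and>
     (\<exists>t z. weiner_ext S a v t \<and> is_arg_min length (\<lambda>z. t @ z \<in> PSTree_nodes S) z \<and> u = t @ z)}"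

definition explicit_weiner_links ::
    "('s, 'p) pstring \<Rightarrow> ('s nstring \<times> ('s + nat) \<times> 's nstring) set" where
  "explicit_weiner_links S = {(v, a, u) \<in> weiner_links S. weiner_ext S a v u}"

definition implicit_weiner_links ::
    "('s, 'p) pstring \<Rightarrow> ('s nstring \<times> ('s + nat) \<times> 's nstring) set" where
  "implicit_weiner_links S = weiner_links S - explicit_weiner_links S"

end

theory Submission
  imports Defs
begin

text \<open>
  Reversal turns right positions into occurrences as prefixes: \<open>i\<close> is a right position of
  \<open>prev S\<close> in \<open>prev T\<close> iff \<open>prev (rev S)\<close> is a prefix of \<open>prev (rev (take i T))\<close>, and these words
  are exactly the elements of \<open>PSuffix (rev T)\<close>, with distinct lengths. Hence the classes that form
  the PDAWG are the mirror images of the classes of words of the trie of \<open>PSuffix (rev T)\<close> having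
  the same set of extensions in \<open>PSuffix (rev T)\<close>. Such a class is a chain of prefixes running down
  one edge of the compacted trie: its longest element is the node at the lower end, and its shortest
  element is one symbol longer than the node at the upper end. Appending \<open>a\<close> to a factor corresponds
  to \<open>\<alpha>(a, _)\<close>, so the target of a PDAWG edge is the node below \<open>\<alpha>(a, _)\<close>.
\<close>

section \<open>The prev encoding and its reversal\<close>

lemma length_prev [simp]: "length (prev S) = length S"
  by (simp add: prev_def)

lemma prev_Nil [simp]: "prev [] = []"
  by (simp add: prev_def)

lemma prev_nth_Inl: "i < length S \<Longrightarrow> S ! i = Inl c \<Longrightarrow> prev S ! i = Inl c"
  by (simp add: prev_def)

lemma prev_nth_first:
  "i < length S \<Longrightarrow> S ! i = Inr p \<Longrightarrow> (\<And>j. j < i \<Longrightarrow> S ! j \<noteq> Inr p) \<Longrightarrow> prev S ! i = Inr 0"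
  by (auto simp: prev_def)

lemma prev_nth_repeat:
  assumes "i < length S" "S ! i = Inr p" "j < i" "S ! j = Inr p"
    and "\<And>k. j < k \<Longrightarrow> k < i \<Longrightarrow> S ! k \<noteq> Inr p"
  shows "prev S ! i = Inr (i - j)"
proof -
  have "Max {k. k < i \<and> S ! k = Inr p} = j"
    using assms by (intro Max_eqI) (auto intro: leI)
  then show ?thesis
    using assms by (auto simp: prev_def)
qed

text \<open>Replaces the \<open>Max\<close> in the definition of \<open>prev\<close> by explicit
  cases: later arguments only see the last earlier occurrence \<open>j\<close> and the gap after
  it.\<close>

lemma prev_nth_cases:
  assumes "i < length S"
  obtains (Static) c where "S ! i = Inl c" "prev S ! i = Inl c"
  | (First) p where "S ! i = Inr p" "\<And>j. j < i \<Longrightarrow> S ! j \<noteq> Inr p" "prev S ! i = Inr 0"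
  | (Repeat) p j where "S ! i = Inr p" "j < i" "S ! j = Inr p"
      "\<And>k. j < k \<Longrightarrow> k < i \<Longrightarrow> S ! k \<noteq> Inr p" "prev S ! i = Inr (i - j)"
proof (cases "S ! i")
  case (Inl c)
  show ?thesis by (rule Static[OF Inl prev_nth_Inl[OF assms Inl]])
next
  case (Inr p)
  show ?thesis
  proof (cases "\<exists>j<i. S ! j = Inr p")
    case False
    then have fresh: "S ! j \<noteq> Inr p" if "j < i" for j using that by blast
    show ?thesis by (rule First[OF Inr fresh prev_nth_first[OF assms Inr fresh]])
  next
    case True
    define J where "J = {j. j < i \<and> S ! j = Inr p}"
    have J: "finite J" "J \<noteq> {}" using True by (auto simp: J_def)
    have "Max J \<in> J" using J by (rule Max_in)
    then have 1: "Max J < i" "S ! Max J = Inr p" by (auto simp: J_def)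
    have 2: "S ! k \<noteq> Inr p" if "Max J < k" "k < i" for k
    proof
      assume "S ! k = Inr p"
      then have "k \<in> J" using that(2) by (simp add: J_def)
      then show False using Max_ge[OF J(1)] that(1) by (simp add: not_le[symmetric])
    qed
    show ?thesis by (rule Repeat[OF Inr 1 2 prev_nth_repeat[OF assms Inr 1 2]])
  qed
qed

lemma prev_nth_bound: "i < length S \<Longrightarrow> prev S ! i = Inr d \<Longrightarrow> d \<le> i"
  by (erule prev_nth_cases) auto

text \<open>An entry depends only on the symbols up to its own position. Hence prefixes of
  pv-strings are pv-strings.\<close>

lemma prev_take: "prev (take k S) = take k (prev S)"
proof (rule nth_equalityI)
  fix i assume "i < length (prev (take k S))"
  then have i: "i < k" "i < length S" by auto
  from i(2) show "prev (take k S) ! i = take k (prev S) ! i"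
  proof (cases rule: prev_nth_cases)
    case Static
    then show ?thesis using i by (simp add: prev_nth_Inl)
  next
    case (First p)
    then show ?thesis using i by (simp add: prev_nth_first)
  next
    case (Repeat p j)
    then show ?thesis using i prev_nth_repeat[of i "take k S" p j] by simp
  qed
qed simp

lemma length_reencode [simp]: "length (reencode x) = length x"
  by (simp add: reencode_def)

lemma reencode_take: "reencode (take k x) = take k (reencode x)"
  by (rule nth_equalityI) (auto simp: reencode_def)

text \<open>The distance at index \<open>k + i\<close> reaches back to some \<open>j\<close>. If
  \<open>k \<le> j\<close>, that occurrence survives the cut and the distance is at most
  \<open>i\<close>; otherwise the distance exceeds \<open>i\<close>, so \<open>Z\<close> resets it
  to 0, and the parameter is indeed new in \<open>drop k S\<close>.\<close>

lemma reencode_drop_prev: "reencode (drop k (prev S)) = prev (drop k S)"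
proof (rule nth_equalityI)
  fix i assume "i < length (reencode (drop k (prev S)))"
  then have i: "k + i < length S" by simp
  then have "[0..<length S - k] ! i = i" by simp
  with i have Z: "reencode (drop k (prev S)) ! i = Z (prev S ! (k + i)) i"
    by (simp add: reencode_def)
  from i have "prev (drop k S) ! i = Z (prev S ! (k + i)) i"
  proof (cases rule: prev_nth_cases)
    case Static
    then show ?thesis using i by (simp add: prev_nth_Inl)
  next
    case (First p)
    then show ?thesis using i by (simp add: prev_nth_first)
  next
    case (Repeat p j)
    show ?thesis
    proof (cases "k \<le> j")
      case True
      then have "prev (drop k S) ! i = Inr (i - (j - k))"
        using i Repeat by (intro prev_nth_repeat[of _ _ p]) auto
      then show ?thesis using True Repeat(2,5) by (simp add: add.commute)
    next
      case False
      have "prev (drop k S) ! i = Inr 0"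
        using i Repeat False by (intro prev_nth_first[of _ _ p]) auto
      then show ?thesis using False Repeat by simp
    qed
  qed
  with Z show "reencode (drop k (prev S)) ! i = prev (drop k S) ! i" by simp
qed simp

lemma reencode_factor_prev:
  "reencode (take k (drop i (prev S))) = prev (take k (drop i S))"
  by (simp add: reencode_take reencode_drop_prev prev_take)

section \<open>Effect of appending or prepending one symbol\<close>

lemma prev_snoc: "\<exists>a. prev (S @ [b]) = prev S @ [a]"
proof -
  have "prev S = take (length S) (prev (S @ [b]))"
    using prev_take[of "length S" "S @ [b]"] by simp
  then have "prev (S @ [b]) = prev S @ [prev (S @ [b]) ! length S]"
    by (metis length_append_singleton length_prev lessI take_Suc_conv_app_nth take_all order_refl)
  then show ?thesis ..
qed

lemma prev_snoc_eqI: "prev (S @ [b]) ! length S = a \<Longrightarrow> prev (S @ [b]) = prev S @ [a]"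
  using prev_snoc[of S b] by (metis length_prev nth_append_length)

lemma prev_snoc_Inl: "prev (S @ [Inl c]) = prev S @ [Inl c]"
  by (intro prev_snoc_eqI prev_nth_Inl) auto

lemma prev_snoc_fresh: "Inr p \<notin> set S \<Longrightarrow> prev (S @ [Inr p]) = prev S @ [Inr 0]"
  by (intro prev_snoc_eqI prev_nth_first) (auto simp: nth_append in_set_conv_nth)

text \<open>The first occurrence of \<open>p\<close> in \<open>R\<close>, at index
  \<open>n - 1\<close>, becomes the last one in \<open>rev R\<close>, at index
  \<open>length R - n\<close>, hence at distance \<open>n\<close> from the appended symbol.\<close>

lemma prev_snoc_repeat:
  assumes "0 < n" "n \<le> length R" "R ! (n - 1) = Inr p" "\<And>k. k < n - 1 \<Longrightarrow> R ! k \<noteq> Inr p"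
  shows "prev (rev R @ [Inr p]) = prev (rev R) @ [Inr n]"
proof (rule prev_snoc_eqI)
  have "prev (rev R @ [Inr p]) ! length (rev R) = Inr (length (rev R) - (length R - n))"
  proof (rule prev_nth_repeat[of _ _ p])
    fix k assume "length R - n < k" "k < length (rev R)"
    then show "(rev R @ [Inr p]) ! k \<noteq> Inr p"
      using assms by (auto simp: nth_append rev_nth)
  qed (use assms in \<open>auto simp: nth_append rev_nth\<close>)
  then show "prev (rev R @ [Inr p]) ! length (rev R) = Inr n"
    using assms by simp
qed

lemma prev_Cons_Inl: "prev (Inl c # R) = Inl c # prev R"
proof (rule nth_equalityI)
  fix i assume i: "i < length (prev (Inl c # R))"
  show "prev (Inl c # R) ! i = (Inl c # prev R) ! i"
  proof (cases i)
    case 0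
    then show ?thesis by (simp add: prev_nth_Inl)
  next
    case (Suc l)
    then have "l < length R" using i by simp
    then show ?thesis
    proof (cases rule: prev_nth_cases)
      case Static
      then show ?thesis using i Suc by (simp add: prev_nth_Inl)
    next
      case (First p)
      then have "prev (Inl c # R) ! i = Inr 0"
        using i Suc by (intro prev_nth_first[of _ _ p]) (auto simp: nth_Cons split: nat.splits)
      then show ?thesis using First Suc by simp
    next
      case (Repeat p j)
      then have "prev (Inl c # R) ! i = Inr (i - Suc j)"
        using i Suc by (intro prev_nth_repeat[of _ _ p]) (auto simp: nth_Cons split: nat.splits)
      then show ?thesis using Repeat Suc by simp
    qed
  qed
qed simp

lemma prev_Cons_fresh:
  assumes "Inr p \<notin> set R"
  shows "prev (Inr p # R) = Inr 0 # prev R"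
proof (rule nth_equalityI)
  fix i assume i: "i < length (prev (Inr p # R))"
  show "prev (Inr p # R) ! i = (Inr 0 # prev R) ! i"
  proof (cases i)
    case 0
    then show ?thesis by (simp add: prev_nth_first)
  next
    case (Suc l)
    then have l: "l < length R" using i by simp
    then show ?thesis
    proof (cases rule: prev_nth_cases)
      case Static
      then show ?thesis using i Suc by (simp add: prev_nth_Inl)
    next
      case (First q)
      have "q \<noteq> p" using First(1) l assms by (metis nth_mem)
      then have "prev (Inr p # R) ! i = Inr 0"
        using First i Suc by (intro prev_nth_first[of _ _ q]) (auto simp: nth_Cons split: nat.splits)
      then show ?thesis using First Suc by simp
    next
      case (Repeat q j)
      then have "prev (Inr p # R) ! i = Inr (i - Suc j)"
        using i Suc by (intro prev_nth_repeat[of _ _ q]) (auto simp: nth_Cons split: nat.splits)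
      then show ?thesis using Repeat Suc by simp
    qed
  qed
qed simp

text \<open>Only the first occurrence of \<open>p\<close> in \<open>R\<close> sees the new symbol:
  its 0 becomes the distance \<open>Suc m\<close>, while later occurrences still refer to an
  occurrence inside \<open>R\<close>.\<close>

lemma prev_Cons_repeat:
  assumes m: "m < length R" "R ! m = Inr p" "\<And>k. k < m \<Longrightarrow> R ! k \<noteq> Inr p"
  shows "prev (Inr p # R) = Inr 0 # (prev R)[m := Inr (Suc m)]"
proof (rule nth_equalityI)
  fix i assume i: "i < length (prev (Inr p # R))"
  show "prev (Inr p # R) ! i = (Inr 0 # (prev R)[m := Inr (Suc m)]) ! i"
  proof (cases i)
    case 0
    then show ?thesis by (simp add: prev_nth_first)
  next
    case (Suc l)
    then have l: "l < length R" using i by simp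
    show ?thesis
    proof (cases "l = m")
      case True
      have "prev (Inr p # R) ! i = Inr (i - 0)"
        using m Suc True by (intro prev_nth_repeat[of _ _ p]) (auto simp: nth_Cons split: nat.splits)
      then show ?thesis using True Suc m by simp
    next
      case False
      from l show ?thesis
      proof (cases rule: prev_nth_cases)
        case Static
        then show ?thesis using i Suc False by (simp add: prev_nth_Inl)
      next
        case (First q)
        have "q \<noteq> p" using First(1,2) m False by (metis nat_neq_iff)
        then have "prev (Inr p # R) ! i = Inr 0"
          using First i Suc by (intro prev_nth_first[of _ _ q]) (auto simp: nth_Cons split: nat.splits)
        then show ?thesis using First Suc False by simp
      next
        case (Repeat q j)
        then have "prev (Inr p # R) ! i = Inr (i - Suc j)"
          using i Suc by (intro prev_nth_repeat[of _ _ q]) (auto simp: nth_Cons split: nat.splits)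
        then show ?thesis using Repeat Suc False by simp
      qed
    qed
  qed
qed simp

lemma obtain_first_index:
  assumes "a \<in> set R"
  obtains m where "m < length R" "R ! m = a" "\<And>k. k < m \<Longrightarrow> R ! k \<noteq> a"
proof -
  have "\<exists>m. m < length R \<and> R ! m = a" using assms by (auto simp: in_set_conv_nth)
  then obtain m where m: "m < length R \<and> R ! m = a"
    "\<And>k. k < m \<Longrightarrow> \<not> (k < length R \<and> R ! k = a)"
    using exists_least_iff[of "\<lambda>m. m < length R \<and> R ! m = a"] by blast
  show ?thesis by (rule that[of m]) (use m in auto)
qed

text \<open>Induction on the last symbol. A repeated parameter is appended with label
  \<open>Suc m\<close>, where \<open>m\<close> is its first index in \<open>rev S\<close>;
  \<open>pv_reverse\<close> then overwrites entry \<open>m\<close>, exactly as prepending the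
  parameter to \<open>rev S\<close> does.\<close>

theorem pv_reverse_prev: "pv_reverse (prev S) = prev (rev S)"
proof (induction S rule: rev_induct)
  case (snoc a S)
  show ?case
  proof (cases a)
    case (Inl c)
    then show ?thesis using snoc by (simp add: prev_snoc_Inl prev_Cons_Inl pv_reverse_snoc)
  next
    case (Inr p)
    show ?thesis
    proof (cases "Inr p \<in> set S")
      case False
      then show ?thesis
        using snoc Inr by (simp add: prev_snoc_fresh prev_Cons_fresh pv_reverse_snoc)
    next
      case True
      then have "Inr p \<in> set (rev S)" by simp
      then obtain m where m: "m < length (rev S)" "rev S ! m = Inr p"
        "\<And>k. k < m \<Longrightarrow> rev S ! k \<noteq> Inr p"
        by (rule obtain_first_index) blast
      have "prev (S @ [a]) = prev S @ [Inr (Suc m)]"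
        using prev_snoc_repeat[of "Suc m" "rev S" p] m Inr by simp
      moreover have "prev (rev (S @ [a])) = Inr 0 # (prev (rev S))[m := Inr (Suc m)]"
        using prev_Cons_repeat[of m "rev S" p] m Inr by simp
      ultimately show ?thesis
        using snoc m by (simp add: pv_reverse_snoc upd_conv_take_nth_drop)
    qed
  qed
qed simp

lemma pv_reverse_involution: "x \<in> pv_strings TYPE('p) \<Longrightarrow> pv_reverse (pv_reverse x) = x"
  by (auto simp: pv_strings_def pv_reverse_prev)

text \<open>\<open>pv_reverse\<close> computes the code of the reversal from the code alone, without
  access to the string.\<close>

lemma prev_eq_iff_prev_rev: "prev S = prev S' \<longleftrightarrow> prev (rev S) = prev (rev S')"
  by (metis pv_reverse_prev rev_rev_ident)

section \<open>Parameterized factors and Weiner extensions\<close>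

lemma sublist_iff_take_drop: "sublist x y \<longleftrightarrow> (\<exists>k i. x = take k (drop i y))"
proof
  assume "sublist x y"
  then obtain ps ss where "y = ps @ x @ ss" by (auto simp: sublist_def)
  then have "x = take (length x) (drop (length ps) y)" by simp
  then show "\<exists>k i. x = take k (drop i y)" by blast
next
  assume "\<exists>k i. x = take k (drop i y)"
  then show "sublist x y"
    by (meson sublist_take sublist_drop sublist_order.order.trans)
qed

lemma PFactor_prev: "PFactor (prev S) = {prev R | R. sublist R S}"
proof -
  have "PFactor (prev S) = {reencode (take k (drop i (prev S))) | k i. True}"
    unfolding PFactor_def sublist_iff_take_drop by blast
  then show ?thesis
    unfolding sublist_iff_take_drop reencode_factor_prev by blast
qed

lemma PFactor_prev_rev:
  fixes R T :: "('s, 'p) pstring"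
  shows "prev R \<in> PFactor (prev (rev T)) \<longleftrightarrow> prev (rev R) \<in> PFactor (prev T)"
proof -
  have "(\<exists>Q::('s, 'p) pstring. prev R = prev Q \<and> sublist Q (rev T)) \<longleftrightarrow>
      (\<exists>Q::('s, 'p) pstring. prev (rev R) = prev Q \<and> sublist Q T)"
    by (metis prev_eq_iff_prev_rev[where ?'b='p and ?'c='p] rev_rev_ident sublist_rev)
  then show ?thesis by (simp add: PFactor_prev)
qed

text \<open>The bridge between labels on both sides: the distance from an appended parameter back to
  its last occurrence in \<open>S\<close> is the 1-based position of its first occurrence in
  \<open>rev S\<close>, so the symbol selected by the Weiner label is the appended one.\<close>

lemma weiner_ext_iff:
  assumes x: "x \<in> PFactor (prev T)"
  shows "weiner_ext (rev T) a (pv_reverse x) u \<longleftrightarrow>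
    x @ [a] \<in> PFactor (prev T) \<and> u = pv_reverse (x @ [a])"
proof
  assume "x @ [a] \<in> PFactor (prev T) \<and> u = pv_reverse (x @ [a])"
  then obtain Q where Q: "x @ [a] = prev Q" "sublist Q T" and u: "u = pv_reverse (x @ [a])"
    by (auto simp: PFactor_prev)
  then obtain S b where S: "Q = S @ [b]"
    by (metis length_0_conv length_prev rev_exhaust snoc_eq_iff_butlast)
  have xa: "x = prev S" "prev (S @ [b]) ! length S = a"
    using Q(1) prev_snoc[of S b] S nth_append_length[of "prev S" a] by auto
  define R where "R = rev S"
  have "sublist S T"
    using Q(2) S sublist_order.order.trans[of S "S @ [b]" T] by auto
  then have R: "sublist R (rev T)" "pv_reverse x = prev R"
    by (auto simp: R_def xa pv_reverse_prev)
  have uR: "u = prev (b # R)" by (simp add: u Q S R_def pv_reverse_prev)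
  have uF: "u \<in> PFactor (prev (rev T))"
    unfolding uR using Q S by (subst PFactor_prev_rev) (auto simp: R_def PFactor_prev)
  have step: "n \<le> length R \<and> pv_reverse x ! (n - 1) = Inr 0 \<and> u = prev (R ! (n - 1) # R)"
    if a: "a = Inr n" "n > 0" for n
  proof -
    have "length S < length (S @ [b])" by simp
    then show ?thesis
    \<comment> \<open>The other two cases give a static symbol or 0, contradicting a positive label.
      Here index \<open>j = length S - n\<close> of \<open>S\<close> becomes index
      \<open>n - 1\<close> of \<open>R\<close>.\<close>
    proof (cases rule: prev_nth_cases)
      case (Repeat p j)
      have n: "n = length S - j" using Repeat(5) xa a by simp
      have b: "b = Inr p" using Repeat by simp
      have j: "j < length S" "S ! j = Inr p" "\<And>k. j < k \<Longrightarrow> k < length S \<Longrightarrow> S ! k \<noteq> Inr p"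
        using Repeat(2-4) by (auto simp: nth_append split: if_splits)
      have Rn: "R ! (n - 1) = Inr p" using j n by (simp add: R_def rev_nth)
      have "prev R ! (n - 1) = Inr 0"
        using j n by (intro prev_nth_first[OF _ Rn]) (auto simp: R_def rev_nth)
      then show ?thesis using Rn b uR n R by (auto simp: R_def)
    qed (use xa a in auto)
  qed
  show "weiner_ext (rev T) a (pv_reverse x) u"
  proof (cases a)
    case (Inl c)
    then show ?thesis using R uF by (auto simp: weiner_ext_def u pv_reverse_snoc)
  next
    case (Inr n)
    then show ?thesis
      using R uF step by (cases "n = 0") (auto simp: weiner_ext_def u pv_reverse_snoc)
  qed
next
  assume ext: "weiner_ext (rev T) a (pv_reverse x) u"
  then obtain R where R: "sublist R (rev T)" "pv_reverse x = prev R"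
    unfolding weiner_ext_def by blast
  from x obtain X where "x = prev X" "sublist X T" by (auto simp: PFactor_prev)
  then have xR: "x = prev (rev R)" using R by (metis pv_reverse_prev rev_rev_ident)
  have "u \<in> PFactor (prev (rev T))" using ext by (simp add: weiner_ext_def)
  then obtain Q where Q: "u = prev Q" "sublist Q (rev T)" by (auto simp: PFactor_prev)
  have QF: "prev (rev Q) \<in> PFactor (prev T)"
    using Q by (metis PFactor_prev_rev \<open>u \<in> PFactor (prev (rev T))\<close>)
  \<comment> \<open>This equation suffices: with \<open>QF\<close> it gives membership, and
    \<open>pv_reverse_prev\<close> turns it into the value of \<open>u\<close>.\<close>
  have "prev (rev Q) = x @ [a]"
  proof (cases a)
    case (Inl c)
    then have "prev Q = prev (Inl c # R)" using ext Q R by (auto simp: weiner_ext_def prev_Cons_Inl)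
    then have "prev (rev Q) = prev (rev R @ [Inl c])" using prev_eq_iff_prev_rev by fastforce
    then show ?thesis using Inl xR by (simp add: prev_snoc_Inl)
  next
    case (Inr n)
    show ?thesis
    proof (cases "n = 0")
      case True
      then have QR: "prev Q = Inr 0 # prev R" using ext Q R Inr by (auto simp: weiner_ext_def)
      then obtain q Q' where QQ: "Q = q # Q'" by (cases Q) auto
      have len: "length Q' = length R"
        using arg_cong[OF QR, of length] QQ by simp
      have "prev Q ! 0 = Inr 0" using QR by simp
      then obtain p where p: "q = Inr p"
        using prev_nth_Inl[of 0 Q] QQ by (cases q) auto
      \<comment> \<open>A repetition of the head parameter at index \<open>m\<close> of
        \<open>Q'\<close> would put the distance \<open>Suc m\<close> at index \<open>m\<close> of
        \<open>prev R\<close>, beyond what \<open>prev_nth_bound\<close> allows.\<close>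
      have "Inr p \<notin> set Q'"
      proof
        assume "Inr p \<in> set Q'"
        then obtain m where m: "m < length Q'" "Q' ! m = Inr p" "\<And>k. k < m \<Longrightarrow> Q' ! k \<noteq> Inr p"
          by (rule obtain_first_index) blast
        then have "prev R = (prev Q')[m := Inr (Suc m)]"
          using QR QQ p prev_Cons_repeat[of m Q' p] by simp
        then have "prev R ! m = Inr (Suc m)" using m by simp
        then show False using prev_nth_bound[of m R "Suc m"] m len by simp
      qed
      then have "prev R = prev Q'" "prev (rev Q) = prev (rev Q') @ [Inr 0]"
        using QR QQ p by (simp_all add: prev_Cons_fresh prev_snoc_fresh)
      then show ?thesis using xR True Inr by (metis prev_eq_iff_prev_rev)
    next
      case False
      \<comment> \<open>The conditions on the selected symbol concern a witness \<open>R'\<close>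
        that shares only its code with \<open>R\<close>. The entry 0 at \<open>n - 1\<close>, with
        \<open>u\<close> formed from that symbol, leaves two options: static symbols keep their own
        code, so it is a parameter at its first occurrence in \<open>R'\<close>.\<close>
      then obtain R' where R': "sublist R' (rev T)" "prev R = prev R'" "n \<le> length R'"
        "prev R' ! (n - 1) = Inr 0" "u = prev (R' ! (n - 1) # R')"
        using ext R Inr by (auto simp: weiner_ext_def)
      have "n - 1 < length R'" using R' False by simp
      then obtain p where p: "R' ! (n - 1) = Inr p" "\<And>j. j < n - 1 \<Longrightarrow> R' ! j \<noteq> Inr p"
        using R'(4) by (cases rule: prev_nth_cases) auto
      have "prev Q = prev (Inr p # R')" using Q R' p by simp
      then have "prev (rev Q) = prev (rev R' @ [Inr p])" using prev_eq_iff_prev_rev by fastforce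
      also have "\<dots> = prev (rev R') @ [Inr n]"
        using R' False p by (intro prev_snoc_repeat) auto
      also have "prev (rev R') = x" using R'(2) xR by (metis prev_eq_iff_prev_rev)
      finally show ?thesis using Inr by simp
    qed
  qed
  then show "x @ [a] \<in> PFactor (prev T) \<and> u = pv_reverse (x @ [a])"
    using QF Q by (metis pv_reverse_prev rev_rev_ident)
qed


section \<open>Words with equal occurrence sets in a trie\<close>

definition occ :: "'a list set \<Rightarrow> 'a list \<Rightarrow> 'a list set" where
  "occ W v = {s \<in> W. prefix v s}"

definition occ_class :: "'a list set \<Rightarrow> 'a list \<Rightarrow> 'a list set" where
  "occ_class W v = {u. occ W u = occ W v}"

text \<open>For \<open>v\<close> in the trie and \<open>[] \<in> W\<close>, this is the first node
  of the compacted trie at or below \<open>v\<close>.\<close>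

definition locus :: "'a list set \<Rightarrow> 'a list \<Rightarrow> 'a list" where
  "locus W v = longest (occ_class W v)"

text \<open>\<open>ARG_MAX\<close> chooses among all elements of maximal length; the last assumption
  makes the choice unique.\<close>

lemma longest_eqI:
  assumes "m \<in> A" "\<And>y. y \<in> A \<Longrightarrow> length y \<le> length m"
    and "\<And>y. y \<in> A \<Longrightarrow> length y = length m \<Longrightarrow> y = m"
  shows "longest A = m"
proof -
  have "longest A \<in> A \<and> (\<forall>y. y \<in> A \<longrightarrow> length y \<le> length (longest A))"
    unfolding longest_def
    by (rule arg_max_nat_lemma[of "\<lambda>x. x \<in> A" m length "Suc (length m)"])
      (use assms(1,2) in \<open>auto simp: less_Suc_eq_le\<close>)
  then show ?thesis using assms by (meson le_antisym)
qed

lemma shortest_in: "y \<in> A \<Longrightarrow> shortest A \<in> A"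
  unfolding shortest_def by (rule arg_min_natI)

lemma shortest_le: "y \<in> A \<Longrightarrow> length (shortest A) \<le> length y"
  unfolding shortest_def by (rule arg_min_nat_le)

lemma trie_iff_occ: "v \<in> trie W \<longleftrightarrow> occ W v \<noteq> {}"
  by (auto simp: trie_def occ_def)

lemma occ_antimono: "prefix u v \<Longrightarrow> occ W v \<subseteq> occ W u"
  by (auto simp: occ_def intro: prefix_order.trans)

text \<open>Some word of \<open>W\<close> has both \<open>u\<close> and \<open>v\<close> as
  prefixes.\<close>

lemma occ_subset_comparable: "v \<in> trie W \<Longrightarrow> occ W v \<subseteq> occ W u \<Longrightarrow> prefix u v \<or> prefix v u"
  unfolding trie_def occ_def by (blast dest: prefix_same_cases)

lemma prefix_trie: "prefix u v \<Longrightarrow> v \<in> trie W \<Longrightarrow> u \<in> trie W"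
  by (auto simp: trie_def intro: prefix_order.trans)

lemma occ_class_comparable:
  "v \<in> trie W \<Longrightarrow> u \<in> occ_class W v \<Longrightarrow> u' \<in> occ_class W v \<Longrightarrow> prefix u u' \<or> prefix u' u"
  using occ_subset_comparable[of u' W u] by (auto simp: occ_class_def trie_iff_occ)

lemma occ_class_eq_length:
  "v \<in> trie W \<Longrightarrow> u \<in> occ_class W v \<Longrightarrow> u' \<in> occ_class W v \<Longrightarrow> length u = length u' \<Longrightarrow> u = u'"
  using occ_class_comparable[of v W u u'] by (auto simp: prefix_def)

lemma occ_class_longest:
  assumes v: "v \<in> trie W"
  shows "locus W v \<in> occ_class W v" "\<And>u. u \<in> occ_class W v \<Longrightarrow> length u \<le> length (locus W v)"
proof -
  \<comment> \<open>Every member of the class is a prefix of \<open>s\<close>, which bounds the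
    lengths and so makes the \<open>ARG_MAX\<close> meaningful.\<close>
  obtain s where s: "s \<in> occ W v" using v by (auto simp: trie_iff_occ)
  have "length u < Suc (length s)" if "u \<in> occ_class W v" for u
    using that s prefix_length_le[of u s] by (auto simp: occ_class_def occ_def set_eq_iff less_Suc_eq_le)
  then have "locus W v \<in> occ_class W v \<and> (\<forall>u. u \<in> occ_class W v \<longrightarrow> length u \<le> length (locus W v))"
    unfolding locus_def longest_def
    by (intro arg_max_nat_lemma[of _ v _ "Suc (length s)"]) (auto simp: occ_class_def)
  then show "locus W v \<in> occ_class W v" "\<And>u. u \<in> occ_class W v \<Longrightarrow> length u \<le> length (locus W v)"
    by auto
qed

lemma prefix_locus: "v \<in> trie W \<Longrightarrow> u \<in> occ_class W v \<Longrightarrow> prefix u (locus W v)"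
  using occ_class_comparable[of v W u "locus W v"] occ_class_longest[of v W]
  by (metis append_eq_conv_conj prefix_def prefix_length_le take_all prefix_order.refl)

lemma occ_locus: "v \<in> trie W \<Longrightarrow> occ W (locus W v) = occ W v"
  using occ_class_longest(1)[of v W] by (simp add: occ_class_def)

lemma locus_trie: "v \<in> trie W \<Longrightarrow> locus W v \<in> trie W"
  by (simp add: trie_iff_occ occ_locus)

lemma locus_cong: "occ W u = occ W v \<Longrightarrow> locus W u = locus W v"
  by (simp add: locus_def occ_class_def)

section \<open>Nodes and edges of the compacted trie\<close>

lemma strict_prefix_child: "prefix v s \<Longrightarrow> v \<noteq> s \<Longrightarrow> \<exists>a. prefix (v @ [a]) s"
  by (metis append_Nil2 append_one_prefix prefix_def prefix_length_le prefix_order.le_neq_trans prefix_length_less)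

text \<open>If the locus lies strictly below \<open>v\<close>, all words below \<open>v\<close>
  share the next symbol, so \<open>v\<close> neither branches nor belongs to \<open>W\<close>.
  Conversely, at a non-node the unique child has the same occurrences, so \<open>v\<close> is not
  longest in its class. The assumption \<open>[] \<in> W\<close> makes the root its own
  locus.\<close>

theorem compact_node_iff:
  assumes W: "[] \<in> W"
  shows "v \<in> compact_nodes W \<longleftrightarrow> v \<in> trie W \<and> locus W v = v"
proof (intro iffI conjI)
  assume v: "v \<in> compact_nodes W"
  then show vt: "v \<in> trie W" by (simp add: compact_nodes_def)
  show "locus W v = v"
  proof (rule ccontr)
    assume ne: "locus W v \<noteq> v"
    have "prefix v (locus W v)" using prefix_locus[OF vt] by (simp add: occ_class_def)
    then obtain c where c: "prefix (v @ [c]) (locus W v)"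
      using ne strict_prefix_child by metis
    have all: "prefix (v @ [c]) s" if "s \<in> W" "prefix v s" for s
    proof -
      have "s \<in> occ W (locus W v)" using that occ_locus[OF vt] by (simp add: occ_def)
      then show ?thesis using c prefix_order.trans by (auto simp: occ_def)
    qed
    have child: "a = c" if "v @ [a] \<in> trie W" for a
    proof -
      obtain s where s: "s \<in> W" "prefix (v @ [a]) s" using \<open>v @ [a] \<in> trie W\<close> by (auto simp: trie_def)
      then have "prefix (v @ [c]) s" using all append_prefixD by blast
      then show ?thesis using s by (auto simp: prefix_def)
    qed
    have "v \<notin> W" using all[of v] by (auto dest: prefix_length_le)
    then show False
      using v child W by (auto simp: compact_nodes_def)
  qed
next
  assume v: "v \<in> trie W \<and> locus W v = v"
  show "v \<in> compact_nodes W"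
  proof (rule ccontr)
    assume n: "v \<notin> compact_nodes W"
    obtain s where s: "s \<in> W" "prefix v s" using v by (auto simp: trie_def)
    have "v \<notin> W" using n v by (auto simp: compact_nodes_def)
    then obtain c where c: "prefix (v @ [c]) s" using s strict_prefix_child by metis
    have "occ W v \<subseteq> occ W (v @ [c])"
    proof
      fix t assume t: "t \<in> occ W v"
      then obtain d where d: "prefix (v @ [d]) t"
        using \<open>v \<notin> W\<close> strict_prefix_child[of v t] by (auto simp: occ_def)
      have "v @ [d] \<in> trie W" "v @ [c] \<in> trie W"
        using c d s t by (auto simp: trie_def occ_def)
      then have "d = c" using n v by (auto simp: compact_nodes_def)
      then show "t \<in> occ W (v @ [c])" using d t by (simp add: occ_def)
    qed
    then have "v @ [c] \<in> occ_class W v"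
      using occ_antimono[of v "v @ [c]" W] by (auto simp: occ_class_def)
    then show False using occ_class_longest(2)[of v W "v @ [c]"] v by simp
  qed
qed

lemma locus_node: "[] \<in> W \<Longrightarrow> v \<in> trie W \<Longrightarrow> locus W v \<in> compact_nodes W"
  using locus_cong[OF occ_locus] by (simp add: compact_node_iff locus_trie)

text \<open>Both \<open>u\<close> and the locus lie on a common path. Were \<open>u\<close> above
  the locus, it would lie between \<open>v\<close> and the locus and share their occurrences, yet a
  node is its own locus.\<close>

lemma locus_prefix_node:
  assumes W: "[] \<in> W" and u: "u \<in> compact_nodes W" and vu: "prefix v u"
  shows "prefix (locus W v) u"
proof -
  have ut: "u \<in> trie W" "locus W u = u" using u compact_node_iff[OF W] by auto
  have vt: "v \<in> trie W" using prefix_trie[OF vu ut(1)] .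
  have sub: "occ W u \<subseteq> occ W (locus W v)" using occ_antimono[OF vu] occ_locus[OF vt] by auto
  show ?thesis
  proof (rule ccontr)
    assume *: "\<not> prefix (locus W v) u"
    then have "prefix u (locus W v)" using occ_subset_comparable[OF ut(1) sub] by auto
    then have "occ W u = occ W (locus W v)" using occ_antimono sub by blast
    then have "locus W u = locus W v" using occ_locus[OF vt] locus_cong by metis
    then show False using * ut by simp
  qed
qed

text \<open>Turns the minimal \<open>z\<close> in the definition of Weiner links into a locus: the
  locus is a node, and every node below \<open>v\<close> extends it.\<close>

lemma shortest_extension_to_node:
  assumes W: "[] \<in> W" and v: "v \<in> trie W"
  shows "is_arg_min length (\<lambda>z. v @ z \<in> compact_nodes W) z \<longleftrightarrow> v @ z = locus W v"
proof -
  have "prefix v (locus W v)" using prefix_locus[OF v] by (simp add: occ_class_def)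
  then obtain z0 where z0: "locus W v = v @ z0" by (auto simp: prefix_def)
  have node: "v @ z0 \<in> compact_nodes W" using locus_node[OF W v] z0 by simp
  have ext: "\<exists>r. z = z0 @ r" if "v @ z \<in> compact_nodes W" for z
    using locus_prefix_node[OF W that, of v] z0 by (auto simp: prefix_def)
  show ?thesis
  proof
    assume "is_arg_min length (\<lambda>z. v @ z \<in> compact_nodes W) z"
    then have "v @ z \<in> compact_nodes W" "\<not> length z0 < length z"
      using node by (auto simp: is_arg_min_def)
    then show "v @ z = locus W v" using ext[of z] z0 by auto
  next
    assume "v @ z = locus W v"
    then have "z = z0" using z0 by simp
    then show "is_arg_min length (\<lambda>z. v @ z \<in> compact_nodes W) z"
      using node by (fastforce simp: is_arg_min_def dest: ext)
  qed
qed

text \<open>The parent of \<open>v\<close> is its shortest class member without the last symbol. The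
  \<open>locus\<close> is kept on the right because the target class of a suffix link is named by
  its longest element.\<close>

theorem compact_edge_iff:
  assumes W: "[] \<in> W" and v: "x @ y \<in> compact_nodes W" "x @ y \<noteq> []"
  shows "(x, y, x @ y) \<in> compact_edges W \<longleftrightarrow> x = locus W (butlast (shortest (occ_class W (x @ y))))"
proof -
  define v where "v = x @ y"
  define s where "s = shortest (occ_class W v)"
  define p where "p = butlast s"
  have vt: "v \<in> trie W" "locus W v = v" using v compact_node_iff[OF W] by (auto simp: v_def)
  have vv: "v \<in> occ_class W v" by (simp add: occ_class_def)
  have s: "s \<in> occ_class W v" unfolding s_def using vv by (rule shortest_in)
  have s_min: "length s \<le> length u" if "u \<in> occ_class W v" for u
    unfolding s_def using that by (rule shortest_le)
  have "s \<noteq> []"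
  proof
    assume "s = []"
    then have "[] \<in> occ W v" using s W by (auto simp: occ_class_def occ_def)
    then show False using v by (auto simp: occ_def v_def)
  qed
  then have len: "length s = Suc (length p)" and ps: "prefix p s"
    by (auto simp: p_def prefixeq_butlast)
  have sv: "prefix s v" using prefix_locus[OF vt(1) s] vt by simp
  have pv: "prefix p v" using ps sv by (rule prefix_order.trans)
  have pt: "p \<in> trie W" using prefix_trie[OF pv vt(1)] .
  \<comment> \<open>A word between \<open>s\<close> and \<open>v\<close> has the occurrences of
    both, so the only node there is \<open>v\<close>.\<close>
  have above: "z = v" if z: "z \<in> compact_nodes W" "prefix z v" "length s \<le> length z" for z
  proof -
    have "prefix s z" using prefix_length_prefix[OF sv z(2) z(3)] .
    then have "occ W z = occ W v"
      using occ_antimono[of s z W] occ_antimono[OF z(2), of W] s by (auto simp: occ_class_def)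
    then have "locus W z = locus W v" by (rule locus_cong)
    then show ?thesis using z vt compact_node_iff[OF W] by simp
  qed
  \<comment> \<open>Otherwise \<open>p\<close> would be a class member shorter than
    \<open>s\<close>. By \<open>above\<close>, the node \<open>locus W p\<close> is then no longer
    than \<open>p\<close>, so \<open>p\<close> is itself a node.\<close>
  have "locus W p \<noteq> v"
  proof
    assume "locus W p = v"
    then have "p \<in> occ_class W v" using occ_locus[OF pt] by (simp add: occ_class_def)
    then show False using s_min len by fastforce
  qed
  moreover have lp: "prefix (locus W p) v" "locus W p \<in> compact_nodes W"
    using locus_prefix_node[OF W _ pv] locus_node[OF W pt] v by (auto simp: v_def)
  ultimately have "length (locus W p) \<le> length p"
    using above[of "locus W p"] len by fastforce
  moreover have "prefix p (locus W p)" using prefix_locus[OF pt] by (simp add: occ_class_def)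
  ultimately have "locus W p = p" by (auto simp: prefix_def)
  then have p: "locus W p = p" "p \<in> compact_nodes W" using lp by auto
  have plen: "length p < length v" using len prefix_length_le[OF sv] by simp
  have "(x, y, v) \<in> compact_edges W \<longleftrightarrow> x = p"
  proof
    assume e: "(x, y, v) \<in> compact_edges W"
    then have x: "x \<in> compact_nodes W" "prefix x v" "x \<noteq> v"
      by (auto simp: compact_edges_def)
    then have xp: "length x \<le> length p" using above[of x] len by fastforce
    then have "prefix x p" using prefix_length_prefix[OF x(2) pv] by blast
    moreover have "strict_prefix p v" using pv plen by (auto simp: strict_prefix_def)
    ultimately show "x = p" using e p by (auto simp: compact_edges_def strict_prefix_def)
  next
    assume x: "x = p"
    have "\<not> (strict_prefix p z \<and> strict_prefix z v)" if "z \<in> compact_nodes W" for z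
      using above[OF that] len prefix_length_less[of p z]
      by (metis Suc_leI strict_prefix_def)
    then show "(x, y, v) \<in> compact_edges W"
      using x p v plen by (auto simp: compact_edges_def v_def)
  qed
  then show ?thesis using p by (simp add: v_def p_def s_def)
qed

section \<open>Right positions and occurrences in the reversed text\<close>

lemma length_pv_reverse [simp]: "length (pv_reverse (prev S)) = length (prev S)"
  by (simp add: pv_reverse_prev)

lemma PSuffix_rev: "PSuffix (rev T) = (\<lambda>i. prev (rev (take i T))) ` {..length T}"
proof -
  have "suffix S (rev T) \<longleftrightarrow> (\<exists>i\<le>length T. S = rev (take i T))" for S
  proof -
    have "suffix S (rev T) \<longleftrightarrow> prefix (rev S) T" by (simp add: suffix_to_prefix)
    also have "\<dots> \<longleftrightarrow> (\<exists>i\<le>length T. rev S = take i T)"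
      by (metis append_eq_conv_conj nat_le_linear prefix_def prefix_length_le take_all take_is_prefix)
    also have "\<dots> \<longleftrightarrow> (\<exists>i\<le>length T. S = rev (take i T))" by (metis rev_rev_ident)
    finally show ?thesis .
  qed
  then show ?thesis by (auto simp: PSuffix_def)
qed

text \<open>Supplies the assumption \<open>[] \<in> W\<close> of the trie results.\<close>

lemma Nil_PSuffix: "[] \<in> PSuffix S"
  by (auto simp: PSuffix_def intro: exI[of _ "[]"])

lemma RPos_iff_prefix:
  "i \<in> RPos (prev T) (prev S) \<longleftrightarrow> i \<le> length T \<and> prefix (prev (rev S)) (prev (rev (take i T)))"
proof (cases "length S \<le> i \<and> i \<le> length T")
  case True
  have "rev (take (length S) (drop (i - length S) T)) = take (length S) (rev (take i T))"
    using True by (simp add: take_rev drop_take min_absorb2)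
  then have "prev S = prev (take (length S) (drop (i - length S) T))
      \<longleftrightarrow> prev (rev S) = take (length S) (prev (rev (take i T)))"
    by (subst prev_eq_iff_prev_rev) (simp add: prev_take)
  also have "\<dots> \<longleftrightarrow> prefix (prev (rev S)) (prev (rev (take i T)))"
    by (metis append_eq_conv_conj length_prev length_rev prefix_def take_is_prefix)
  finally show ?thesis using True by (simp add: RPos_def reencode_factor_prev)
next
  case False
  then show ?thesis by (auto simp: RPos_def dest: prefix_length_le)
qed

lemma occ_pv_reverse:
  "occ (PSuffix (rev T)) (pv_reverse (prev S)) =
    (\<lambda>i. prev (rev (take i T))) ` RPos (prev T) (prev S)"
  by (auto simp: occ_def PSuffix_rev RPos_iff_prefix pv_reverse_prev)

lemma RPos_eq_iff_occ_eq:
  assumes "x \<in> pv_strings TYPE('p)" "y \<in> pv_strings TYPE('p)"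
  shows "RPos (prev (T :: ('s, 'p) pstring)) x = RPos (prev T) y \<longleftrightarrow>
    occ (PSuffix (rev T)) (pv_reverse x) = occ (PSuffix (rev T)) (pv_reverse y)"
proof -
  \<comment> \<open>The word with index \<open>i\<close> has length \<open>i\<close>, so comparing
    images amounts to comparing position sets.\<close>
  have "inj_on (\<lambda>i. prev (rev (take i T))) {..length T}"
  proof (rule inj_onI)
    fix i j assume "i \<in> {..length T}" "j \<in> {..length T}"
      and "prev (rev (take i T)) = prev (rev (take j T))"
    then have "length (prev (rev (take i T))) = length (prev (rev (take j T)))" by simp
    then show "i = j" using \<open>i \<in> _\<close> \<open>j \<in> _\<close> by simp
  qed
  moreover have "RPos (prev T) z \<subseteq> {..length T}" for z by (auto simp: RPos_def)
  ultimately show ?thesis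
    using assms by (auto simp: pv_strings_def occ_pv_reverse inj_on_image_eq_iff)
qed

lemma PFactor_pv_string: "x \<in> PFactor (prev (T :: ('s, 'p) pstring)) \<Longrightarrow> x \<in> pv_strings TYPE('p)"
  by (auto simp: PFactor_prev pv_strings_def)

lemma PFactor_iff_RPos: "x \<in> PFactor (prev T) \<longleftrightarrow> RPos (prev T) x \<noteq> {}"
proof
  assume "x \<in> PFactor (prev T)"
  then obtain ps R ss where "x = prev R" "T = ps @ R @ ss"
    by (auto simp: PFactor_prev sublist_def)
  then have "length ps + length R \<in> RPos (prev T) x"
    by (simp add: RPos_def reencode_factor_prev)
  then show "RPos (prev T) x \<noteq> {}" by blast
next
  assume "RPos (prev T) x \<noteq> {}"
  then show "x \<in> PFactor (prev T)"
    by (auto simp: RPos_def PFactor_def) (metis sublist_iff_take_drop)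
qed

lemma PFactor_iff_trie:
  assumes "x \<in> pv_strings TYPE('p)"
  shows "x \<in> PFactor (prev (T :: ('s, 'p) pstring)) \<longleftrightarrow> pv_reverse x \<in> trie (PSuffix (rev T))"
  using assms by (auto simp: PFactor_iff_RPos trie_iff_occ pv_strings_def occ_pv_reverse)

text \<open>By \<open>prev_take\<close>, prefixes of codes are codes; so \<open>pv_reverse\<close>
  is an involution on the words of the trie.\<close>

lemma trie_PSuffix_pv_string:
  assumes "v \<in> trie (PSuffix (S :: ('s, 'p) pstring))"
  shows "v \<in> pv_strings TYPE('p)"
proof -
  obtain S' :: "('s, 'p) pstring" where "prefix v (prev S')"
    using assms by (auto simp: trie_def PSuffix_def)
  then have "v = prev (take (length v) S')" by (auto simp: prev_take prefix_def)
  then show ?thesis by (auto simp: pv_strings_def)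
qed

section \<open>Mirror images of the classes and of their extreme elements\<close>

lemma pv_reverse_pv_string: "x \<in> pv_strings TYPE('p) \<Longrightarrow> pv_reverse x \<in> pv_strings TYPE('p)"
  by (auto simp: pv_strings_def pv_reverse_prev)

lemma pv_reverse_eq_iff:
  "x \<in> pv_strings TYPE('p) \<Longrightarrow> y \<in> pv_strings TYPE('p) \<Longrightarrow> pv_reverse x = pv_reverse y \<longleftrightarrow> x = y"
  by (metis pv_reverse_involution)

text \<open>\<open>RClass\<close> ranges over arbitrary strings; a nonempty position set forces its
  members to be factors, hence pv-strings.\<close>

lemma RClass_PFactor:
  "x \<in> PFactor (prev T) \<Longrightarrow> y \<in> RClass (prev T) x \<Longrightarrow> y \<in> PFactor (prev T)"
  by (simp add: PFactor_iff_RPos RClass_def)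

lemma RClass_eq_iff: "RClass w x = RClass w y \<longleftrightarrow> RPos w x = RPos w y"
  by (auto simp: RClass_def)

text \<open>Nonempty occurrence sets confine both classes to pv-strings, where
  \<open>pv_reverse\<close> is an involution and \<open>RPos_eq_iff_occ_eq\<close> applies.\<close>

lemma occ_class_image:
  fixes T :: "('s, 'p) pstring"
  assumes x: "x \<in> PFactor (prev T)"
  shows "occ_class (PSuffix (rev T)) (pv_reverse x) = pv_reverse ` RClass (prev T) x"
proof (intro equalityI subsetI)
  have xp: "x \<in> pv_strings TYPE('p)" using x by (rule PFactor_pv_string)
  fix v assume v: "v \<in> occ_class (PSuffix (rev T)) (pv_reverse x)"
  then have "v \<in> trie (PSuffix (rev T))"
    using x xp by (simp add: PFactor_iff_trie occ_class_def trie_iff_occ)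
  then have vp: "v \<in> pv_strings TYPE('p)" by (rule trie_PSuffix_pv_string)
  then have "pv_reverse v \<in> RClass (prev T) x"
    using v xp by (simp add: RClass_def RPos_eq_iff_occ_eq pv_reverse_pv_string
        pv_reverse_involution[OF vp] occ_class_def)
  then show "v \<in> pv_reverse ` RClass (prev T) x"
    using pv_reverse_involution[OF vp] by (metis imageI)
next
  fix v assume "v \<in> pv_reverse ` RClass (prev T) x"
  then obtain y where y: "v = pv_reverse y" "y \<in> RClass (prev T) x" by blast
  have "x \<in> pv_strings TYPE('p)" "y \<in> pv_strings TYPE('p)"
    using x y RClass_PFactor PFactor_pv_string by blast+
  then show "v \<in> occ_class (PSuffix (rev T)) (pv_reverse x)"
    using y by (simp add: RClass_def occ_class_def RPos_eq_iff_occ_eq)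
qed

lemma pv_string_length_pv_reverse: "x \<in> pv_strings TYPE('p) \<Longrightarrow> length (pv_reverse x) = length x"
  by (auto simp: pv_strings_def)

text \<open>\<open>pv_reverse\<close> preserves length and is injective on pv-strings, so maximality
  and uniqueness of the longest element carry over from the trie.\<close>

lemma pv_reverse_longest:
  fixes T :: "('s, 'p) pstring"
  assumes x: "x \<in> PFactor (prev T)"
  shows "longest (RClass (prev T) x) \<in> RClass (prev T) x"
    and "pv_reverse (longest (RClass (prev T) x)) = locus (PSuffix (rev T)) (pv_reverse x)"
proof -
  let ?W = "PSuffix (rev T)" and ?v = "pv_reverse x"
  have vt: "?v \<in> trie ?W" using x PFactor_iff_trie PFactor_pv_string by blast
  obtain m where m: "m \<in> RClass (prev T) x" "locus ?W ?v = pv_reverse m"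
    using occ_class_longest(1)[OF vt] occ_class_image[OF x] by auto
  have pv: "y \<in> pv_strings TYPE('p)" if "y \<in> RClass (prev T) x" for y
    using that RClass_PFactor[OF x] PFactor_pv_string by blast
  have cl: "pv_reverse y \<in> occ_class ?W ?v" if "y \<in> RClass (prev T) x" for y
    using that occ_class_image[OF x] by auto
  have "longest (RClass (prev T) x) = m"
  proof (rule longest_eqI[OF m(1)])
    fix y assume y: "y \<in> RClass (prev T) x"
    show "length y \<le> length m"
      using occ_class_longest(2)[OF vt cl[OF y]] m
      by (simp add: pv_string_length_pv_reverse[OF pv] y)
    assume "length y = length m"
    then have "pv_reverse y = pv_reverse m"
      using occ_class_eq_length[OF vt cl[OF y] cl[OF m(1)]]
      by (simp add: pv_string_length_pv_reverse[OF pv] y m(1))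
    then show "y = m" using pv_reverse_eq_iff[OF pv[OF y] pv[OF m(1)]] by simp
  qed
  then show "longest (RClass (prev T) x) \<in> RClass (prev T) x"
    and "pv_reverse (longest (RClass (prev T) x)) = locus ?W ?v"
    using m by auto
qed

lemma pv_reverse_shortest:
  fixes T :: "('s, 'p) pstring"
  assumes x: "x \<in> PFactor (prev T)"
  shows "shortest (RClass (prev T) x) \<in> RClass (prev T) x"
    and "pv_reverse (shortest (RClass (prev T) x)) = shortest (occ_class (PSuffix (rev T)) (pv_reverse x))"
proof -
  let ?C = "RClass (prev T) x" and ?D = "occ_class (PSuffix (rev T)) (pv_reverse x)"
  have vt: "pv_reverse x \<in> trie (PSuffix (rev T))"
    using x PFactor_iff_trie PFactor_pv_string by blast
  have "x \<in> ?C" by (simp add: RClass_def)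
  then show s: "shortest ?C \<in> ?C" by (rule shortest_in)
  have pv: "y \<in> pv_strings TYPE('p)" if "y \<in> ?C" for y
    using that RClass_PFactor[OF x] PFactor_pv_string by blast
  have D: "?D = pv_reverse ` ?C" using occ_class_image[OF x] .
  have sD: "pv_reverse (shortest ?C) \<in> ?D" using s D by auto
  then have D': "shortest ?D \<in> ?D" by (rule shortest_in)
  then obtain m where m: "m \<in> ?C" "shortest ?D = pv_reverse m" using D by auto
  \<comment> \<open>Equal lengths suffice, since a class is a chain of prefixes and has at most one
    element of each length.\<close>
  have "length (shortest ?D) = length (pv_reverse (shortest ?C))"
    using shortest_le[OF sD] shortest_le[OF m(1)] m
    by (simp add: pv_string_length_pv_reverse[OF pv] s)
  then show "pv_reverse (shortest ?C) = shortest ?D"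
    using occ_class_eq_length[OF vt D' sD] by simp
qed

text \<open>Dropping the first symbol of \<open>S\<close> drops the last one of
  \<open>rev S\<close>, and there \<open>prev_take\<close> shows that no re-encoding occurs.\<close>

lemma pv_reverse_reencode_tl:
  fixes x :: "'s nstring"
  assumes "x \<in> pv_strings TYPE('p)"
  shows "pv_reverse (reencode (tl x)) = butlast (pv_reverse x)"
proof -
  obtain S :: "('s, 'p) pstring" where S: "x = prev S" using assms by (auto simp: pv_strings_def)
  have "reencode (tl x) = prev (tl S)"
    using reencode_drop_prev[of 1 S] by (simp add: S drop_Suc)
  then have "pv_reverse (reencode (tl x)) = prev (rev (tl S))" by (simp add: pv_reverse_prev)
  also have "rev (tl S) = take (length S - 1) (rev S)"
    by (metis butlast_conv_take butlast_rev length_rev)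
  finally show ?thesis
    by (simp add: S pv_reverse_prev prev_take butlast_conv_take)
qed

section \<open>Correspondence of nodes, edges and links\<close>

theorem longest_node_iff:
  fixes T :: "('s, 'p) pstring"
  assumes x: "x \<in> pv_strings TYPE('p)"
  shows "x \<in> longest ` PDAWG_nodes (prev T) \<longleftrightarrow> pv_reverse x \<in> PSTree_nodes (rev T)"
proof
  assume "x \<in> longest ` PDAWG_nodes (prev T)"
  then obtain z where z: "z \<in> PFactor (prev T)" "x = longest (RClass (prev T) z)"
    by (auto simp: PDAWG_nodes_def)
  then show "pv_reverse x \<in> PSTree_nodes (rev T)"
    using pv_reverse_longest(2)[OF z(1)] locus_node[OF Nil_PSuffix]
      PFactor_iff_trie PFactor_pv_string[OF z(1)]
    by (metis PSTree_nodes_def)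
next
  assume "pv_reverse x \<in> PSTree_nodes (rev T)"
  then have n: "pv_reverse x \<in> trie (PSuffix (rev T))" "locus (PSuffix (rev T)) (pv_reverse x) = pv_reverse x"
    by (auto simp: PSTree_nodes_def compact_node_iff[OF Nil_PSuffix])
  then have xF: "x \<in> PFactor (prev T)" using PFactor_iff_trie[OF x] by blast
  have "longest (RClass (prev T) x) = x"
    using pv_reverse_longest[OF xF] n x pv_reverse_eq_iff RClass_PFactor[OF xF] PFactor_pv_string
    by metis
  then show "x \<in> longest ` PDAWG_nodes (prev T)"
    using xF by (metis PDAWG_nodes_def imageI)
qed

text \<open>The name of a node lies in its class, so the class can be recovered from the
  name.\<close>

lemma longest_node_PFactor:
  fixes T :: "('s, 'p) pstring"
  assumes "x \<in> longest ` PDAWG_nodes (prev T)"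
  shows "x \<in> PFactor (prev T)" "longest (RClass (prev T) x) = x"
proof -
  obtain z where z: "z \<in> PFactor (prev T)" "x = longest (RClass (prev T) z)"
    using assms by (auto simp: PDAWG_nodes_def)
  have "x \<in> RClass (prev T) z" using pv_reverse_longest(1)[OF z(1)] z(2) by simp
  then show "x \<in> PFactor (prev T)" using RClass_PFactor[OF z(1)] by simp
  have "RClass (prev T) x = RClass (prev T) z"
    using \<open>x \<in> RClass (prev T) z\<close> by (simp add: RClass_def)
  then show "longest (RClass (prev T) x) = x" using z(2) by simp
qed

lemma named_edge_iff:
  fixes T :: "('s, 'p) pstring"
  shows "(x, a, y) \<in> name_edge ` PDAWG_edges (prev T) \<longleftrightarrow>
    x \<in> longest ` PDAWG_nodes (prev T) \<and> x @ [a] \<in> PFactor (prev T) \<and>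
    y = longest (RClass (prev T) (x @ [a]))"
proof
  assume "(x, a, y) \<in> name_edge ` PDAWG_edges (prev T)"
  then show "x \<in> longest ` PDAWG_nodes (prev T) \<and> x @ [a] \<in> PFactor (prev T) \<and>
      y = longest (RClass (prev T) (x @ [a]))"
    by (auto simp: PDAWG_edges_def name_edge_def PDAWG_nodes_def)
next
  assume r: "x \<in> longest ` PDAWG_nodes (prev T) \<and> x @ [a] \<in> PFactor (prev T) \<and>
      y = longest (RClass (prev T) (x @ [a]))"
  then have "x \<in> PFactor (prev T)" "longest (RClass (prev T) x) = x"
    using longest_node_PFactor by blast+
  then have "(RClass (prev T) x, a, RClass (prev T) (x @ [a])) \<in> PDAWG_edges (prev T)"
    using r unfolding PDAWG_edges_def by fastforce
  moreover have "(x, a, y) = name_edge (RClass (prev T) x, a, RClass (prev T) (x @ [a]))"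
    using r \<open>longest (RClass (prev T) x) = x\<close> by (simp add: name_edge_def)
  ultimately show "(x, a, y) \<in> name_edge ` PDAWG_edges (prev T)" by blast
qed

lemma named_primary_iff:
  "(x, a, y) \<in> name_edge ` PDAWG_primary w \<longleftrightarrow> (x, a, y) \<in> name_edge ` PDAWG_edges w \<and> y = x @ [a]"
  by (force simp: PDAWG_primary_def name_edge_def image_iff)

text \<open>Being primary depends only on the named triple of an edge, so naming respects the set
  difference.\<close>

lemma named_secondary_iff:
  "(x, a, y) \<in> name_edge ` PDAWG_secondary w \<longleftrightarrow> (x, a, y) \<in> name_edge ` PDAWG_edges w \<and> y \<noteq> x @ [a]"
  by (force simp: PDAWG_secondary_def PDAWG_primary_def name_edge_def image_iff)

text \<open>By \<open>weiner_ext_iff\<close> the extension is the mirror image of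
  \<open>x @ [a]\<close>, and its locus is the mirror image of the longest element of the class of
  \<open>x @ [a]\<close>, the name of the edge target.\<close>

theorem weiner_link_iff:
  fixes T :: "('s, 'p) pstring"
  assumes x: "x \<in> pv_strings TYPE('p)" and y: "y \<in> pv_strings TYPE('p)"
  shows "(pv_reverse x, a, pv_reverse y) \<in> weiner_links (rev T) \<longleftrightarrow>
    (x, a, y) \<in> name_edge ` PDAWG_edges (prev T)"
proof (cases "x \<in> longest ` PDAWG_nodes (prev T) \<and> x @ [a] \<in> PFactor (prev T)")
  case True
  then have xF: "x \<in> PFactor (prev T)" and xa: "x @ [a] \<in> PFactor (prev T)"
    using longest_node_PFactor by blast+
  have node: "pv_reverse x \<in> PSTree_nodes (rev T)" using True longest_node_iff[OF x] by blast
  let ?t = "pv_reverse (x @ [a])" and ?m = "longest (RClass (prev T) (x @ [a]))"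
  have "?t \<in> trie (PSuffix (rev T))" using xa PFactor_iff_trie PFactor_pv_string by blast
  note arg = shortest_extension_to_node[OF Nil_PSuffix this]
  \<comment> \<open>Provides the witness for the existentially quantified extension in
    \<open>weiner_links\<close>.\<close>
  have pre: "\<exists>z. locus (PSuffix (rev T)) ?t = ?t @ z"
    using prefix_locus[OF \<open>?t \<in> trie _\<close>, of ?t] by (auto simp: occ_class_def prefix_def)
  have "(pv_reverse x, a, pv_reverse y) \<in> weiner_links (rev T) \<longleftrightarrow>
      (\<exists>z. ?t @ z = locus (PSuffix (rev T)) ?t \<and> pv_reverse y = ?t @ z)"
    using node xa by (simp add: weiner_links_def weiner_ext_iff[OF xF] arg PSTree_nodes_def)
  also have "\<dots> \<longleftrightarrow> pv_reverse y = pv_reverse ?m"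
    unfolding pv_reverse_longest(2)[OF xa] using pre by auto
  also have "\<dots> \<longleftrightarrow> y = ?m"
    using pv_reverse_eq_iff[OF y PFactor_pv_string[OF RClass_PFactor[OF xa pv_reverse_longest(1)[OF xa]]]] .
  finally show ?thesis using True by (simp add: named_edge_iff)
next
  case False
  then have "(pv_reverse x, a, pv_reverse y) \<notin> weiner_links (rev T)"
    using longest_node_iff[OF x] longest_node_PFactor(1) weiner_ext_iff
    unfolding weiner_links_def by blast
  then show ?thesis using False unfolding named_edge_iff by blast
qed

theorem explicit_weiner_link_iff:
  fixes T :: "('s, 'p) pstring"
  assumes x: "x \<in> pv_strings TYPE('p)" and y: "y \<in> pv_strings TYPE('p)"
  shows "(pv_reverse x, a, pv_reverse y) \<in> explicit_weiner_links (rev T) \<longleftrightarrow>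
    (x, a, y) \<in> name_edge ` PDAWG_edges (prev T) \<and> y = x @ [a]"
proof (cases "(x, a, y) \<in> name_edge ` PDAWG_edges (prev T)")
  case True
  then have "x \<in> PFactor (prev T)" and xa: "x @ [a] \<in> PFactor (prev T)"
    using longest_node_PFactor by (auto simp: named_edge_iff)
  then have "weiner_ext (rev T) a (pv_reverse x) (pv_reverse y) \<longleftrightarrow> y = x @ [a]"
    using pv_reverse_eq_iff[OF y PFactor_pv_string[OF xa]] by (simp add: weiner_ext_iff)
  then show ?thesis using True weiner_link_iff[OF x y] by (simp add: explicit_weiner_links_def)
next
  case False
  then show ?thesis using weiner_link_iff[OF x y] by (simp add: explicit_weiner_links_def)
qed

theorem suffix_link_iff:
  fixes T :: "('s, 'p) pstring"
  assumes xy: "x @ y \<in> pv_strings TYPE('p)"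
  shows "(pv_reverse (x @ y), pv_reverse x) \<in> name_link ` PDAWG_suffix_links (prev T) \<longleftrightarrow>
    (x, y, x @ y) \<in> PSTree_edges (rev T)"
proof -
  let ?W = "PSuffix (rev T)" and ?w = "prev T"
  let ?m = "pv_reverse (x @ y)"
  have x: "x \<in> pv_strings TYPE('p)"
  proof -
    obtain S :: "('s, 'p) pstring" where "x @ y = prev S" using xy by (auto simp: pv_strings_def)
    then have "x = prev (take (length x) S)" by (metis append_eq_conv_conj prev_take)
    then show ?thesis by (auto simp: pv_strings_def)
  qed
  have mp: "?m \<in> pv_strings TYPE('p)" and mm: "pv_reverse ?m = x @ y"
    using xy pv_reverse_pv_string pv_reverse_involution by blast+
  \<comment> \<open>Removes the choice of a class representative: the source class is the class of
    its name \<open>?m\<close>.\<close>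
  have links: "(pv_reverse (x @ y), pv_reverse x) \<in> name_link ` PDAWG_suffix_links ?w \<longleftrightarrow>
      ?m \<in> longest ` PDAWG_nodes ?w \<and> RClass ?w ?m \<noteq> RClass ?w [] \<and>
      pv_reverse x = longest (RClass ?w (reencode (tl (shortest (RClass ?w ?m)))))"
    (is "?L \<longleftrightarrow> ?R")
  proof
    assume ?L
    then obtain z where z: "z \<in> PFactor ?w" "RClass ?w z \<noteq> RClass ?w []"
      "?m = longest (RClass ?w z)"
      "pv_reverse x = longest (RClass ?w (reencode (tl (shortest (RClass ?w z)))))"
      by (auto simp: PDAWG_suffix_links_def PDAWG_nodes_def name_link_def)
    moreover have "RClass ?w ?m = RClass ?w z"
      using pv_reverse_longest(1)[OF z(1)] z(3) by (simp add: RClass_def)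
    ultimately show ?R by (auto simp: PDAWG_nodes_def)
  next
    assume r: ?R
    then have m: "?m \<in> PFactor ?w" "longest (RClass ?w ?m) = ?m" using longest_node_PFactor by blast+
    have "(RClass ?w ?m, RClass ?w (reencode (tl (shortest (RClass ?w ?m))))) \<in> PDAWG_suffix_links ?w"
      using m r by (auto simp: PDAWG_suffix_links_def PDAWG_nodes_def)
    moreover have "(?m, pv_reverse x) =
        name_link (RClass ?w ?m, RClass ?w (reencode (tl (shortest (RClass ?w ?m)))))"
      using m r by (simp add: name_link_def)
    ultimately show ?L by blast
  qed
  show ?thesis
  proof (cases "?m \<in> longest ` PDAWG_nodes ?w \<and> x @ y \<noteq> []")
    case True
    then have m: "?m \<in> PFactor ?w" "longest (RClass ?w ?m) = ?m" using longest_node_PFactor by blast+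
    have node: "x @ y \<in> compact_nodes ?W"
      using True longest_node_iff[OF mp] mm by (simp add: PSTree_nodes_def)
    \<comment> \<open>Position 0 separates the source: only the empty string ends there.\<close>
    have "RClass ?w ?m \<noteq> RClass ?w []"
    proof
      assume eq: "RClass ?w ?m = RClass ?w []"
      have "0 \<in> RPos ?w []" by (simp add: RPos_def reencode_def)
      then have "0 \<in> RPos ?w ?m" using eq by (simp add: RClass_eq_iff)
      then have "?m = []" by (simp add: RPos_def)
      then show False using True mm by simp
    qed
    then have L: "?thesis \<longleftrightarrow>
        (pv_reverse x = longest (RClass ?w (reencode (tl (shortest (RClass ?w ?m))))) \<longleftrightarrow>
        (x, y, x @ y) \<in> PSTree_edges (rev T))"
      using links True by simp
    define s where "s = shortest (RClass ?w ?m)"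
    have sF: "s \<in> PFactor ?w" unfolding s_def
      using RClass_PFactor[OF m(1) pv_reverse_shortest(1)[OF m(1)]] .
    have sr: "pv_reverse s = shortest (occ_class ?W (x @ y))"
      unfolding s_def using pv_reverse_shortest(2)[OF m(1)] mm by simp
    have tF: "reencode (tl s) \<in> PFactor ?w"
    proof -
      obtain R where R: "s = prev R" "sublist R T" using sF by (auto simp: PFactor_prev)
      have "reencode (tl s) = prev (tl R)"
        using reencode_drop_prev[of 1 R] by (simp add: R drop_Suc)
      moreover have "sublist (tl R) T"
        using R(2) sublist_order.order.trans[of "tl R" R T] by (simp add: sublist_tl)
      ultimately show ?thesis by (auto simp: PFactor_prev)
    qed
    define k where "k = longest (RClass ?w (reencode (tl s)))"
    have kp: "k \<in> pv_strings TYPE('p)"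
      unfolding k_def using RClass_PFactor[OF tF pv_reverse_longest(1)[OF tF]] PFactor_pv_string by blast
    have "pv_reverse k = locus ?W (butlast (shortest (occ_class ?W (x @ y))))"
      unfolding k_def pv_reverse_longest(2)[OF tF]
      using pv_reverse_reencode_tl[OF PFactor_pv_string[OF sF]] sr by simp
    then have "(x, y, x @ y) \<in> PSTree_edges (rev T) \<longleftrightarrow> x = pv_reverse k"
      using compact_edge_iff[OF Nil_PSuffix node] True by (simp add: PSTree_edges_def)
    also have "\<dots> \<longleftrightarrow> pv_reverse x = k"
      using pv_reverse_involution[OF kp] pv_reverse_involution[OF x] by metis
    finally show ?thesis using L by (simp add: k_def s_def)
  next
    case False
    \<comment> \<open>Both sides fail here: either \<open>x @ y\<close> is not a node, or it is the
      root, which has no incoming edge and mirrors the source, which has no suffix link.\<close>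
    have "\<not> ((x, y, x @ y) \<in> PSTree_edges (rev T))"
      using False longest_node_iff[OF mp] mm
      by (auto simp: PSTree_edges_def compact_edges_def PSTree_nodes_def)
    moreover have "\<not> (?m \<in> longest ` PDAWG_nodes ?w \<and> RClass ?w ?m \<noteq> RClass ?w [])"
      using False by auto
    ultimately show ?thesis using links by blast
  qed
qed

theorem theorem4:
  fixes T :: "('s, 'p) pstring"
  shows "(\<forall>x \<in> pv_strings TYPE('p).
            x \<in> longest ` PDAWG_nodes (prev T) \<longleftrightarrow> pv_reverse x \<in> PSTree_nodes (rev T))
       \<and> (\<forall>x \<in> pv_strings TYPE('p). \<forall>y \<in> pv_strings TYPE('p). \<forall>a.
            (x, a, y) \<in> name_edge ` PDAWG_primary (prev T) \<longleftrightarrow>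
            (pv_reverse x, a, pv_reverse y) \<in> explicit_weiner_links (rev T))
       \<and> (\<forall>x \<in> pv_strings TYPE('p). \<forall>y \<in> pv_strings TYPE('p). \<forall>a.
            (x, a, y) \<in> name_edge ` PDAWG_secondary (prev T) \<longleftrightarrow>
            (pv_reverse x, a, pv_reverse y) \<in> implicit_weiner_links (rev T))
       \<and> (\<forall>x y. x @ y \<in> pv_strings TYPE('p) \<longrightarrow>
            ((pv_reverse (x @ y), pv_reverse x) \<in> name_link ` PDAWG_suffix_links (prev T) \<longleftrightarrow>
             (x, y, x @ y) \<in> PSTree_edges (rev T)))"
proof (intro conjI ballI allI impI)
  fix x y :: "'s nstring" and a
  assume xy: "x \<in> pv_strings TYPE('p)" "y \<in> pv_strings TYPE('p)"
  show "(x, a, y) \<in> name_edge ` PDAWG_primary (prev T) \<longleftrightarrow>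
      (pv_reverse x, a, pv_reverse y) \<in> explicit_weiner_links (rev T)"
    by (simp only: explicit_weiner_link_iff[OF xy] named_primary_iff)
  \<comment> \<open>Implicit links are all links minus the explicit ones, which removes exactly the
    named edges with \<open>y = x @ [a]\<close>.\<close>
  show "(x, a, y) \<in> name_edge ` PDAWG_secondary (prev T) \<longleftrightarrow>
      (pv_reverse x, a, pv_reverse y) \<in> implicit_weiner_links (rev T)"
    unfolding implicit_weiner_links_def Diff_iff explicit_weiner_link_iff[OF xy]
      weiner_link_iff[OF xy] named_secondary_iff by blast
qed (simp_all only: longest_node_iff suffix_link_iff)

end
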